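(* Let $n\ge1$, $0<\hat\lambda\le e^{-1}$, $\lambda=\hat\lambda/n$, $1\le K\le\infty$, and $p_L=\exp(W_0(-\hat\lambda))$. Suppose the probability of success of $K$-exponential backoff with retransmission factor $0<q<1$ converges to $p_L$, so that the offered load of each queue is $\rho=\rho(p_L,q)$. Then $\rho\le1$ if and only if $q\ge q_l$, where the lower bound $q_l$ is the (positive) root $q$ of the equation $$\frac{q}{p_L+q-1}-\Big(\frac{q}{p_L+q-1}-\frac1{p_L}\Big)\Big(\frac{1-p_L}{q}\Big)^K=\frac1\lambda .$$ In particular, for geometric retransmission ($K=1$) $$q_l^{Geo}=\frac{\lambda(1-p_L)}{p_L(1-\lambda)}=\frac{\hat\lambda(1-p_L)}{p_L(n-\hat\lambda)},$$ and for exponential backoff ($K=\infty$) $$q_l^{Exp}=\frac{1-p_L}{1-\lambda}=\frac{1-p_L}{1-\hat\lambda/n}.$$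
   Context: $W_0$ is the principal real branch of the Lambert W function ($W(z)e^{W(z)}=z$, with $W_0(z)\ge-1$). In $K$-exponential backoff a head-of-line packet that has suffered $i$ collisions (capped at $K$) is transmitted with probability $q^i$ in each slot. With per-node Bernoulli input rate $\lambda$ and success probability $p$, the offered load of each queue is $$\rho(p,q)=\lambda\Big(\frac{q}{p+q-1}-\Big(\frac{q}{p+q-1}-\frac1p\Big)\Big(\frac{1-p}{q}\Big)^K\Big)=\lambda\Big(\sum_{i=0}^{K-1}x^i+\frac{x^K}{p}\Big),\qquad x=\frac{1-p}{q},$$ for $K<\infty$ (the second form giving the value, by continuity, at $p+q=1$; the left-hand side of the equation for $q_l$ is extended in the same way). For $K=\infty$, $\rho(p,q)=\lambda q/(p+q-1)$ if $p+q>1$ and $\rho=+\infty$ if $p+q\le1$, and the equation for $q_l$ reads $q/(p_L+q-1)=1/\lambda$ with $q>1-p_L$. *)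

theory Defs
  imports Complex_Main "HOL-Library.Extended_Nat" "HOL-Library.Extended_Real"
begin

text \<open>Principal real branch of the Lambert W function; meaningful for \<open>z \<ge> - exp (- 1)\<close>.\<close>
definition lambert_W0 :: "real \<Rightarrow> real" where
  "lambert_W0 z = (THE w. w \<ge> - 1 \<and> w * exp w = z)"

text \<open>
  The closed form has a removable singularity at \<open>p + q = 1\<close>; there the value is the
  geometric-sum form, which agrees with the closed form elsewhere
  (lemma \<open>backoff_factor_sum\<close> below).
\<close>
definition backoff_factor :: "nat \<Rightarrow> real \<Rightarrow> real \<Rightarrow> real" where
  "backoff_factor k p q =
     (if p + q \<noteq> 1
      then q / (p + q - 1) - (q / (p + q - 1) - 1 / p) * ((1 - p) / q) ^ k
      else (\<Sum>i<k. ((1 - p) / q) ^ i) + ((1 - p) / q) ^ k / p)"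

lemma backoff_factor_sum:
  assumes "q \<noteq> 0"
  shows "backoff_factor k p q = (\<Sum>i<k. ((1 - p) / q) ^ i) + ((1 - p) / q) ^ k / p"
proof (cases "p + q = 1")
  case True
  then show ?thesis by (simp add: backoff_factor_def)
next
  case False
  define x where "x = (1 - p) / q"
  have x: "x \<noteq> 1" using False assms by (auto simp: x_def field_simps)
  have s: "(\<Sum>i<k. x ^ i) = (1 - x ^ k) / (1 - x)"
    using x by (simp add: sum_gp_strict)
  have "1 - x = (p + q - 1) / q" using assms by (simp add: x_def field_simps)
  then have c: "q / (p + q - 1) = 1 / (1 - x)" by simp
  show ?thesis
    using False unfolding backoff_factor_def x_def[symmetric] c s
    by (simp add: diff_divide_distrib left_diff_distrib)
qed

text \<open>The cutoff phase \<open>K\<close> may be infinite, and then the load may be infinite.\<close>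
definition offered_load :: "real \<Rightarrow> enat \<Rightarrow> real \<Rightarrow> real \<Rightarrow> ereal" where
  "offered_load lam K p q =
     (case K of
        enat k \<Rightarrow> ereal (lam * backoff_factor k p q)
      | \<infinity> \<Rightarrow> if p + q > 1 then ereal (lam * (q / (p + q - 1))) else \<infinity>)"

definition lower_bound_eq :: "real \<Rightarrow> enat \<Rightarrow> real \<Rightarrow> real \<Rightarrow> bool" where
  "lower_bound_eq lam K p q \<longleftrightarrow>
     (case K of
        enat k \<Rightarrow> backoff_factor k p q = 1 / lam
      | \<infinity> \<Rightarrow> q > 1 - p \<and> q / (p + q - 1) = 1 / lam)"

definition q_lower :: "real \<Rightarrow> enat \<Rightarrow> real \<Rightarrow> real" where
  "q_lower lam K p = (THE q. q > 0 \<and> lower_bound_eq lam K p q)"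

end

(*
  The defining equation w exp w = -lam_hat forces W_0(-lam_hat) to lie in [-1, 0), so 0 < p_L < 1.
  In the variable x = (1 - p_L) / q, which decreases in q, the offered load is
  lam (1 + x + ... + x^(K-1) + x^K / p_L): it increases strictly from lam < 1 at x = 0 to infinity.
  (For K = infinity the geometric series plays this role, finite only for x < 1.)
  It therefore equals 1 at exactly one q > 0, and is at most 1 exactly from that q on.
*)
theory Submission
  imports Defs
begin

text \<open>The derivative \<open>(1 + x) * exp x\<close> vanishes at \<open>- 1\<close> and is
  positive to its right, so positivity on the open interval suffices. This makes the description in
  \<open>lambert_W0\<close> unambiguous.\<close>

lemma strict_mono_on_times_exp: "strict_mono_on {- 1..} (\<lambda>w::real. w * exp w)"
proof (rule strict_mono_onI)
  fix a b :: real
  assume a: "a \<in> {- 1..}" and "a < b"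
  show "a * exp a < b * exp b"
  proof (rule DERIV_pos_imp_increasing_open[OF \<open>a < b\<close>])
    fix x assume "a < x"
    have "((\<lambda>w. w * exp w) has_real_derivative (1 + x) * exp x) (at x)"
      by (auto intro!: derivative_eq_intros simp: algebra_simps)
    moreover have "(1 + x) * exp x > 0" using a \<open>a < x\<close> by simp
    ultimately show "\<exists>y. ((\<lambda>w. w * exp w) has_real_derivative y) (at x) \<and> y > 0"
      by blast
  qed (auto intro!: continuous_intros)
qed

lemma lambert_W0_works:
  assumes "- exp (- 1) \<le> z"
  shows "lambert_W0 z \<ge> - 1" "lambert_W0 z * exp (lambert_W0 z) = z"
proof -
  \<comment> \<open>The right end \<open>max 0 z\<close> treats both signs at once: for negative
    \<open>z\<close> the function is 0 there, and otherwise \<open>exp z \<ge> 1\<close> gives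
    \<open>z * exp z \<ge> z\<close>.\<close>
  have "\<exists>w\<ge>- 1. w \<le> max 0 z \<and> w * exp w = z"
  proof (rule IVT')
    show "- 1 * exp (- 1) \<le> z" using assms by simp
    have "z \<le> max 0 z" by simp
    also have "\<dots> \<le> max 0 z * exp (max 0 z)" using mult_left_mono[of 1 "exp (max 0 z)" "max 0 z"] by simp
    finally show "z \<le> max 0 z * exp (max 0 z)" .
  qed (auto intro!: continuous_intros)
  then obtain w where w: "w \<ge> - 1" "w * exp w = z" by blast
  have "v = w" if "v \<ge> - 1 \<and> v * exp v = z" for v
    using strict_mono_on_eq[OF strict_mono_on_times_exp, of v w] w that by simp
  then have "lambert_W0 z = w" unfolding lambert_W0_def using w by (intro the_equality) blast+
  with w show "lambert_W0 z \<ge> - 1" "lambert_W0 z * exp (lambert_W0 z) = z" by auto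
qed

lemma exp_lambert_W0_less_1:
  assumes "- exp (- 1) \<le> z" "z < 0"
  shows "exp (lambert_W0 z) < 1"
proof -
  have "lambert_W0 z * exp (lambert_W0 z) < 0"
    using lambert_W0_works(2)[OF assms(1)] assms(2) by simp
  then show ?thesis by (simp add: mult_less_0_iff)
qed

text \<open>Strictness comes from the last term alone; for \<open>k = 1\<close> the sum is the
  constant 1.\<close>

lemma truncated_geometric_strict_mono:
  fixes p :: real
  assumes "p > 0" "k \<ge> 1"
  shows "strict_mono_on {0..} (\<lambda>x. (\<Sum>i<k. x ^ i) + x ^ k / p)"
  using assms
  by (intro strict_mono_onI add_le_less_mono sum_mono divide_strict_right_mono power_mono
      power_strict_mono) auto

lemma truncated_geometric_attains:
  fixes p c :: real
  assumes "p > 0" "k \<ge> 1" "c > 1"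
  shows "\<exists>x>0. (\<Sum>i<k. x ^ i) + x ^ k / p = c"
proof -
  let ?g = "\<lambda>x. (\<Sum>i<k. x ^ i) + x ^ k / p"
  \<comment> \<open>Since \<open>X \<ge> 1\<close> and \<open>k \<ge> 1\<close>,
    \<open>X ^ k \<ge> X \<ge> p * c\<close>, so the last term by itself already reaches
    \<open>c\<close> at \<open>X\<close>.\<close>
  define X where "X = max 1 (p * c)"
  \<comment> \<open>By \<open>0 ^ 0 = 1\<close> the summand for \<open>i = 0\<close> survives. Hence
    the value at 0 is 1, below \<open>c\<close>, and the solution found is not 0.\<close>
  have "(\<Sum>i<k. (0::real) ^ i) = (\<Sum>i<k. if i = 0 then 1 else 0)"
    by (intro sum.cong) auto
  then have g0: "?g 0 = 1" using assms(2) by simp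
  have "\<exists>x\<ge>0. x \<le> X \<and> ?g x = c"
  proof (rule IVT')
    show "?g 0 \<le> c" using g0 assms(3) by simp
    have "X ^ 1 \<le> X ^ k" using assms(2) by (intro power_increasing) (auto simp: X_def)
    then have "p * c \<le> X ^ k" by (simp add: X_def)
    then have "c \<le> X ^ k / p" using assms(1) by (simp add: field_simps)
    moreover have "(\<Sum>i<k. X ^ i) \<ge> 0" by (intro sum_nonneg) (auto simp: X_def)
    ultimately show "c \<le> ?g X" by linarith
  qed (use assms in \<open>auto intro!: continuous_intros simp: X_def\<close>)
  then obtain x where "x \<ge> 0" "?g x = c" by blast
  with g0 assms(3) show ?thesis by (cases "x = 0") (auto intro!: exI[of _ x])
qed

text \<open>The substitution \<open>x = (1 - p) / q\<close> reverses order on positive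
  \<open>q\<close>, so the unique solution in \<open>x\<close> becomes a threshold from below in
  \<open>q\<close>. One \<open>q0\<close> serves both equivalences: the root is the
  threshold.\<close>

lemma backoff_factor_threshold:
  assumes "0 < p" "p < 1" "k \<ge> 1" "c > 1"
  shows "\<exists>q0>0. \<forall>q>0. (backoff_factor k p q = c \<longleftrightarrow> q = q0)
    \<and> (backoff_factor k p q \<le> c \<longleftrightarrow> q0 \<le> q)"
proof -
  define g where "g = (\<lambda>x. (\<Sum>i<k. x ^ i) + x ^ k / p)"
  obtain x0 where x0: "x0 > 0" "g x0 = c"
    using truncated_geometric_attains[OF assms(1,3,4)] by (auto simp: g_def)
  define q0 where "q0 = (1 - p) / x0"
  have mono: "strict_mono_on {0..} g"
    unfolding g_def by (rule truncated_geometric_strict_mono[OF assms(1,3)])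
  have "(backoff_factor k p q = c \<longleftrightarrow> q = q0) \<and> (backoff_factor k p q \<le> c \<longleftrightarrow> q0 \<le> q)"
    if "q > 0" for q
  proof -
    have f: "backoff_factor k p q = g ((1 - p) / q)"
      using that by (simp add: backoff_factor_sum g_def)
    have nn: "(1 - p) / q \<ge> 0" using that assms by simp
    have "g ((1 - p) / q) = g x0 \<longleftrightarrow> (1 - p) / q = x0"
      using strict_mono_on_eq[OF mono] nn x0(1) by simp
    moreover have "g ((1 - p) / q) \<le> g x0 \<longleftrightarrow> (1 - p) / q \<le> x0"
      using strict_mono_on_less_eq[OF mono] nn x0(1) by simp
    moreover have "(1 - p) / q = x0 \<longleftrightarrow> q = q0" "(1 - p) / q \<le> x0 \<longleftrightarrow> q0 \<le> q"
      using that x0(1) by (auto simp: q0_def field_simps)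
    ultimately show ?thesis using f x0(2) by simp
  qed
  moreover have "q0 > 0" using x0 assms by (simp add: q0_def)
  ultimately show ?thesis by blast
qed

lemma offered_load_threshold:
  assumes "0 < p" "p < 1" "0 < lam" "lam < 1" "K \<ge> 1"
  shows "\<exists>q0>0. \<forall>q>0. (lower_bound_eq lam K p q \<longleftrightarrow> q = q0)
    \<and> (offered_load lam K p q \<le> 1 \<longleftrightarrow> q0 \<le> q)"
proof (cases K)
  case (enat k)
  then have "k \<ge> 1" using assms(5) by (simp add: one_enat_def)
  then obtain q0 where "q0 > 0" and q0: "\<And>q. q > 0 \<Longrightarrow> (backoff_factor k p q = 1 / lam \<longleftrightarrow> q = q0)
      \<and> (backoff_factor k p q \<le> 1 / lam \<longleftrightarrow> q0 \<le> q)"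
    using backoff_factor_threshold[of p k "1 / lam"] assms by auto
  moreover have "offered_load lam K p q \<le> 1 \<longleftrightarrow> backoff_factor k p q \<le> 1 / lam" for q
    using assms(3) enat by (simp add: offered_load_def field_simps)
  ultimately show ?thesis using enat by (auto simp: lower_bound_eq_def)
next
  case infinity
  define q0 where "q0 = (1 - p) / (1 - lam)"
  have "q0 > 0" using assms by (simp add: q0_def)
  \<comment> \<open>Clearing the positive denominator \<open>1 - lam\<close> gives linear
    conditions, valid whatever the sign of \<open>p + q - 1\<close>.\<close>
  have le: "q0 \<le> q \<longleftrightarrow> lam * q \<le> p + q - 1" and eq: "q = q0 \<longleftrightarrow> lam * q = p + q - 1" for q
    using assms by (auto simp: q0_def field_simps)
  have "(lower_bound_eq lam K p q \<longleftrightarrow> q = q0) \<and> (offered_load lam K p q \<le> 1 \<longleftrightarrow> q0 \<le> q)"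
    if "q > 0" for q
  proof (cases "p + q > 1")
    case True
    then have "q / (p + q - 1) = 1 / lam \<longleftrightarrow> lam * q = p + q - 1"
      and "lam * (q / (p + q - 1)) \<le> 1 \<longleftrightarrow> lam * q \<le> p + q - 1"
      using assms by (auto simp: field_simps)
    with True show ?thesis
      by (auto simp: lower_bound_eq_def offered_load_def infinity le eq)
  next
    case False
    \<comment> \<open>Here \<open>p + q - 1 \<le> 0 < lam * q\<close>, so both linear conditions
      fail, in accordance with the infinite load and the side condition \<open>q > 1 - p\<close> of
      the equation.\<close>
    have "lam * q > 0" using assms that by simp
    with False show ?thesis
      by (auto simp: lower_bound_eq_def offered_load_def infinity le eq)
  qed
  with \<open>q0 > 0\<close> show ?thesis by blast
qed

lemma q_lower_threshold:
  assumes "0 < p" "p < 1" "0 < lam" "lam < 1" "K \<ge> 1"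
  shows q_lower_pos: "q_lower lam K p > 0"
    and lower_bound_eq_iff: "q > 0 \<Longrightarrow> lower_bound_eq lam K p q \<longleftrightarrow> q = q_lower lam K p"
    and offered_load_le_1_iff: "q > 0 \<Longrightarrow> offered_load lam K p q \<le> 1 \<longleftrightarrow> q_lower lam K p \<le> q"
proof -
  obtain q0 where q0: "q0 > 0" "\<And>q. q > 0 \<Longrightarrow> (lower_bound_eq lam K p q \<longleftrightarrow> q = q0)
      \<and> (offered_load lam K p q \<le> 1 \<longleftrightarrow> q0 \<le> q)"
    using offered_load_threshold[OF assms] by blast
  then have "q_lower lam K p = q0" unfolding q_lower_def by (intro the_equality) auto
  with q0 show "q_lower lam K p > 0"
    and "q > 0 \<Longrightarrow> lower_bound_eq lam K p q \<longleftrightarrow> q = q_lower lam K p"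
    and "q > 0 \<Longrightarrow> offered_load lam K p q \<le> 1 \<longleftrightarrow> q_lower lam K p \<le> q"
    by auto
qed

text \<open>By uniqueness it is enough to test the candidate: there
  \<open>x = p * (1 - lam) / lam\<close>, whence \<open>1 + x / p = 1 / lam\<close>.\<close>

lemma q_lower_geometric:
  assumes "0 < p" "p < 1" "0 < lam" "lam < 1"
  shows "q_lower lam 1 p = lam * (1 - p) / (p * (1 - lam))"
proof -
  let ?q = "lam * (1 - p) / (p * (1 - lam))"
  have "?q > 0" using assms by simp
  moreover have "(1 - p) / ?q = p * (1 - lam) / lam" using assms by (simp add: field_simps)
  ultimately have "backoff_factor 1 p ?q = 1 / lam"
    using assms by (simp add: backoff_factor_sum field_simps)
  then have "lower_bound_eq lam 1 p ?q" by (simp add: lower_bound_eq_def one_enat_def)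
  with lower_bound_eq_iff[OF assms, of 1 ?q] \<open>?q > 0\<close> show ?thesis by simp
qed

lemma q_lower_exponential:
  assumes "0 < p" "p < 1" "0 < lam" "lam < 1"
  shows "q_lower lam \<infinity> p = (1 - p) / (1 - lam)"
proof -
  let ?q = "(1 - p) / (1 - lam)"
  have "?q > 0" using assms by simp
  \<comment> \<open>This identity yields both requirements: \<open>lam * ?q\<close> is positive,
    which is the side condition, and dividing \<open>?q\<close> by it leaves
    \<open>1 / lam\<close>.\<close>
  have eq: "p + ?q - 1 = lam * ?q" using assms by (simp add: field_simps)
  have "lam * ?q > 0" using \<open>?q > 0\<close> assms(3) by (rule mult_pos_pos[rotated])
  with eq have "?q > 1 - p" by linarith
  moreover have "?q / (p + ?q - 1) = 1 / lam" unfolding eq using \<open>?q > 0\<close> assms by simp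
  ultimately have "lower_bound_eq lam \<infinity> p ?q" by (simp add: lower_bound_eq_def)
  with lower_bound_eq_iff[OF assms, of \<infinity> ?q] \<open>?q > 0\<close> show ?thesis by simp
qed

theorem theorem4:
  fixes n :: nat and lam_hat lam pL :: real and K :: enat
  assumes "n \<ge> 1"
    and "0 < lam_hat" and "lam_hat \<le> exp (- 1)"
    and "lam = lam_hat / real n"
    and "K \<ge> 1"
    and "pL = exp (lambert_W0 (- lam_hat))"
  shows "(\<exists>!q. q > 0 \<and> lower_bound_eq lam K pL q)
    \<and> (\<forall>(q::real) (p :: nat \<Rightarrow> real) (\<rho>::ereal).
          0 < q \<longrightarrow> q < 1 \<longrightarrow>
          (\<forall>t. 0 \<le> p t \<and> p t \<le> 1) \<longrightarrow> p \<longlonglongrightarrow> pL \<longrightarrow>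
          \<rho> = offered_load lam K (lim p) q \<longrightarrow>
          (\<rho> \<le> 1 \<longleftrightarrow> q \<ge> q_lower lam K pL))
    \<and> q_lower lam 1 pL = lam * (1 - pL) / (pL * (1 - lam))
    \<and> q_lower lam 1 pL = lam_hat * (1 - pL) / (pL * (real n - lam_hat))
    \<and> q_lower lam \<infinity> pL = (1 - pL) / (1 - lam)
    \<and> q_lower lam \<infinity> pL = (1 - pL) / (1 - lam_hat / real n)"
proof -
  have p: "0 < pL" "pL < 1"
    using assms(2,3,6) exp_lambert_W0_less_1[of "- lam_hat"] by auto
  have "lam_hat < 1" using assms(3) exp_less_one_iff[of "- 1 :: real"] by linarith
  have "lam \<le> lam_hat" using frac_le[of lam_hat lam_hat 1 "real n"] assms(1,2,4) by simp
  with \<open>lam_hat < 1\<close> have lam: "0 < lam" "lam < 1" using assms(1,2,4) by auto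
  have "\<exists>!q. q > 0 \<and> lower_bound_eq lam K pL q"
    using q_lower_pos[OF p lam assms(5)] lower_bound_eq_iff[OF p lam assms(5)] by blast
  moreover have "\<rho> \<le> 1 \<longleftrightarrow> q \<ge> q_lower lam K pL"
    if "0 < q" "p \<longlonglongrightarrow> pL" "\<rho> = offered_load lam K (lim p) q" for q p \<rho>
    using offered_load_le_1_iff[OF p lam assms(5) that(1)] limI[OF that(2)] that(3) by simp
  \<comment> \<open>Both forms agree after multiplying numerator and denominator by
    \<open>real n\<close>; \<open>lam_hat < 1 \<le> n\<close> keeps \<open>real n - lam_hat\<close>
    away from 0.\<close>
  moreover have "lam * (1 - pL) / (pL * (1 - lam)) = lam_hat * (1 - pL) / (pL * (real n - lam_hat))"
  proof -
    have "real n \<noteq> 0" "real n - lam_hat \<noteq> 0" using assms(1) \<open>lam_hat < 1\<close> by auto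
    then show ?thesis unfolding assms(4) using p by (simp add: divide_simps)
  qed
  ultimately show ?thesis
    unfolding q_lower_geometric[OF p lam] q_lower_exponential[OF p lam] assms(4)[symmetric] by blast
qed

end
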